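(* Let $\mathbf{r}=(r_0,r_1)\in\mathbb{R}^2$. If $\tau_{\mathbf{r}}$ has a cycle of alternating signs, then $|r_0-r_1+1|<\frac12$. Furthermore, $\tau_{\mathbf{r}}$ has a cycle of the form $(t,-t)$ for some $t\in\mathbb{Z}\setminus\{0\}$ if and only if $r_0-r_1+1=0$. Thus, $\{(r_0,r_0+1)\mid r_0\in\mathbb{R}\}$ has empty intersection with $\mathcal{D}_2^{( * )}$.
   Context: For $\mathbf{r}=(r_0,r_1)\in\mathbb{R}^2$, the two-dimensional shift radix system is the map $\tau_{\mathbf{r}}:\mathbb{Z}^2\to\mathbb{Z}^2$, $\tau_{\mathbf{r}}(a_0,a_1)=(a_1,-\lfloor r_0a_0+r_1a_1\rfloor)$. The orbit of $(a_0,a_1)$ is identified with the integer sequence $(a_n)_{n\ge 0}$ where $a_{n+2}=-\lfloor r_0a_n+r_1a_{n+1}\rfloor$ for $n\ge0$. An orbit is ultimately periodic if there are $n_0\ge 0$, $p>0$ with $a_{n+p}=a_n$ for all $n\ge n_0$; in this case $(a_n,\ldots,a_{n+p-1})$ with $n\ge n_0$ is called a cycle of $\tau_{\mathbf{r}}$. A cycle $(a_0,\ldots,a_{p-1})$ has alternating signs if $a_ia_{i+1}<0$ for all $i\in\{0,\ldots,p-1\}$, where $a_p=a_0$. $\mathcal{D}_2^{( * )}$ is the set of all $\mathbf{r}\in\mathbb{R}^2$ such that each ultimately periodic orbit of $\tau_{\mathbf{r}}$ ends up in the trivial cycle $(0)$, i.e. satisfies $a_n=0$ for all sufficiently large $n$.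 *)

theory Defs
  imports Complex_Main
begin

definition srs_map :: "real \<times> real \<Rightarrow> int \<times> int \<Rightarrow> int \<times> int" where
  "srs_map r a = (snd a, - \<lfloor>fst r * of_int (fst a) + snd r * of_int (snd a)\<rfloor>)"

text \<open>The orbit of an integer pair is identified with the sequence of first components of its
  iterates; the lemmas below show that this is the sequence started by the given pair and continued
  by the defining recurrence.\<close>

definition srs_orbit :: "real \<times> real \<Rightarrow> int \<times> int \<Rightarrow> nat \<Rightarrow> int" where
  "srs_orbit r a n = fst ((srs_map r ^^ n) a)"

lemma srs_map_iterate: "(srs_map r ^^ n) a = (srs_orbit r a n, srs_orbit r a (Suc n))"
  by (simp add: srs_orbit_def srs_map_def)

lemma srs_orbit_0: "srs_orbit r (a0, a1) 0 = a0"
  by (simp add: srs_orbit_def)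

lemma srs_orbit_1: "srs_orbit r (a0, a1) (Suc 0) = a1"
  by (simp add: srs_orbit_def srs_map_def)

lemma srs_orbit_rec:
  "srs_orbit (r0, r1) a (n + 2) =
     - \<lfloor>r0 * of_int (srs_orbit (r0, r1) a n) + r1 * of_int (srs_orbit (r0, r1) a (n + 1))\<rfloor>"
  by (simp add: srs_orbit_def srs_map_def)

definition periodic_from :: "nat \<Rightarrow> nat \<Rightarrow> (nat \<Rightarrow> int) \<Rightarrow> bool" where
  "periodic_from n0 p a \<longleftrightarrow> p > 0 \<and> (\<forall>n\<ge>n0. a (n + p) = a n)"

definition ultimately_periodic :: "(nat \<Rightarrow> int) \<Rightarrow> bool" where
  "ultimately_periodic a \<longleftrightarrow> (\<exists>n0 p. periodic_from n0 p a)"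

text \<open>The period of a cycle is not required to be minimal.\<close>

definition srs_cycle :: "real \<times> real \<Rightarrow> int list \<Rightarrow> bool" where
  "srs_cycle r c \<longleftrightarrow>
     (\<exists>a n0 p n. periodic_from n0 p (srs_orbit r a) \<and> n \<ge> n0 \<and>
        c = map (srs_orbit r a) [n..<n + p])"

definition alternating_signs :: "int list \<Rightarrow> bool" where
  "alternating_signs c \<longleftrightarrow> (\<forall>i<length c. c ! i * c ! (Suc i mod length c) < 0)"

definition D2_star :: "(real \<times> real) set" where
  "D2_star = {r. \<forall>a. ultimately_periodic (srs_orbit r a) \<longrightarrow>
                   (\<exists>N. \<forall>n\<ge>N. srs_orbit r a n = 0)}"

end

theory Submission
  imports Defs
begin

text \<open>Put \<open>e\<^sub>n = r\<^sub>0 a\<^sub>n + r\<^sub>1 a\<^sub>n\<^sub>+\<^sub>1 + a\<^sub>n\<^sub>+\<^sub>2 \<in> [0, 1)\<close>. If the sequence has period \<open>p\<close> and alternating signs, all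
  \<open>(-1)\<^sup>n a\<^sub>n\<close> have the same sign, so their sum \<open>B\<close> over two periods satisfies \<open>\<bar>B\<bar> \<ge> 2p\<close>. Summing
  \<open>(-1)\<^sup>n e\<^sub>n\<close> over two periods gives \<open>(r\<^sub>0 - r\<^sub>1 + 1) B\<close>, and pairing consecutive terms bounds this sum
  strictly by \<open>p\<close> in absolute value. Two periods are taken because \<open>(-1)\<^sup>n a\<^sub>n\<close> visibly has period
  \<open>2p\<close>, without knowing that \<open>p\<close> is even. For a cycle \<open>(t, -t)\<close> the recurrence says that
  \<open>x = (r\<^sub>0 - r\<^sub>1) t\<close> satisfies \<open>\<lfloor>x\<rfloor> = -t\<close> and \<open>\<lfloor>-x\<rfloor> = t\<close>, which forces \<open>x = -t\<close>.\<close>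

text \<open>Moving the window one step drops \<open>g k\<close> and adds \<open>g (q + k)\<close>,
  which is the same value.\<close>

lemma sum_periodic_shift:
  fixes g :: "nat \<Rightarrow> 'a::ab_group_add"
  assumes "\<And>n. g (n + q) = g n"
  shows "(\<Sum>n<q. g (n + k)) = (\<Sum>n<q. g n)"
proof (induction k)
  case (Suc k)
  have "(\<Sum>n<q. g (Suc n + k)) + g k = (\<Sum>n<Suc q. g (n + k))"
    by (subst sum.lessThan_Suc_shift) (simp add: add.commute)
  also have "\<dots> = (\<Sum>n<q. g (n + k)) + g k"
    using assms[of k] by (simp add: add.commute)
  finally show ?case using Suc by simp
qed simp

text \<open>Each pair contributes \<open>e (2 * k) - e (2 * k + 1)\<close>, strictly between -1 and
  1. The induction starts at 1, since the strict bound fails for the empty sum.\<close>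

lemma alternating_sum_abs_less:
  fixes e :: "nat \<Rightarrow> real"
  assumes "\<And>n. 0 \<le> e n" "\<And>n. e n < 1" "p > 0"
  shows "\<bar>\<Sum>n<2 * p. (-1) ^ n * e n\<bar> < p"
  using \<open>p > 0\<close>
proof (induction p rule: nat_induct_non_zero)
  case 1
  show ?case using assms(1,2)[of 0] assms(1,2)[of 1] by (simp add: numeral_2_eq_2)
next
  case (Suc k)
  then show ?case using assms(1,2)[of "2 * k"] assms(1,2)[of "Suc (2 * k)"] by simp
qed

lemma periodic_alternating_bound:
  fixes f :: "nat \<Rightarrow> int" and r0 r1 :: real
  assumes lower: "\<And>n. 0 \<le> r0 * f n + r1 * f (n + 1) + f (n + 2)"
    and upper: "\<And>n. r0 * f n + r1 * f (n + 1) + f (n + 2) < 1"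
    and period: "\<And>n. f (n + p) = f n" "p > 0"
    and alternating: "\<And>n. f n * f (Suc n) < 0"
  shows "\<bar>r0 - r1 + 1\<bar> < 1 / 2"
proof -
  define g :: "nat \<Rightarrow> real" where "g n = (-1) ^ n * f n" for n
  define B where "B = (\<Sum>n<2 * p. g n)"
  have nonzero: "f n \<noteq> 0" for n
    using alternating[of n] by auto
  have "f (n + 2 * p) = f n" for n
    using period(1)[of n] period(1)[of "n + p"] by (simp add: mult_2 add.assoc)
  then have "g (n + 2 * p) = g n" for n
    by (simp add: g_def power_add)
  then have shift: "(\<Sum>n<2 * p. g (n + k)) = B" for k
    unfolding B_def by (rule sum_periodic_shift)
  have sgn_f: "sgn (f n) = (-1) ^ n * sgn (f 0)" for n
  proof (induction n)
    case (Suc n)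
    have "sgn (f (Suc n)) = - sgn (f n)"
      using alternating[of n] by (auto simp: mult_less_0_iff)
    with Suc show ?case by simp
  qed simp
  have sgn_g: "g n = sgn (f 0) * \<bar>f n\<bar>" for n
  proof -
    have "(-1) ^ n * f n = (-1) ^ n * (sgn (f n) * \<bar>f n\<bar>)" by (simp add: sgn_mult_abs)
    also have "\<dots> = sgn (f 0) * \<bar>f n\<bar>"
      by (cases "even n") (simp_all add: sgn_f[of n])
    finally have "real_of_int ((-1) ^ n * f n) = real_of_int (sgn (f 0) * \<bar>f n\<bar>)" by simp
    then show ?thesis by (simp add: g_def)
  qed
  have "real (2 * p) = (\<Sum>n<2 * p. 1)" by simp
  also have "\<dots> \<le> (\<Sum>n<2 * p. real_of_int \<bar>f n\<bar>)"
  proof (rule sum_mono)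
    fix n
    have "1 \<le> \<bar>f n\<bar>" using nonzero[of n] by linarith
    then show "1 \<le> real_of_int \<bar>f n\<bar>" by linarith
  qed
  \<comment> \<open>By \<open>sgn_g\<close> the constant \<open>sgn (f 0)\<close> factors out of
    \<open>B\<close>; it has absolute value 1 because \<open>f 0\<close> is nonzero.\<close>
  also have "\<dots> = \<bar>B\<bar>"
    using nonzero[of 0] unfolding B_def sgn_g sum_distrib_left[symmetric] abs_mult
    by (simp add: sgn_if sum_nonneg sum_negf)
  finally have B: "real (2 * p) \<le> \<bar>B\<bar>" .
  \<comment> \<open>Absorbing \<open>(-1) ^ n\<close> into \<open>g\<close> flips the sign only at
    the odd shift; by \<open>shift\<close> all three resulting sums equal \<open>B\<close>.\<close>
  have "(\<Sum>n<2 * p. (-1) ^ n * (r0 * f n + r1 * f (n + 1) + f (n + 2)))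
      = (\<Sum>n<2 * p. r0 * g n - r1 * g (n + 1) + g (n + 2))"
    by (rule sum.cong) (simp_all add: g_def algebra_simps)
  also have "\<dots> = (r0 - r1 + 1) * B"
    using shift[of 0] shift[of 1] shift[of 2]
    by (simp add: sum.distrib sum_subtractf sum_distrib_left[symmetric] algebra_simps)
  finally have "\<bar>r0 - r1 + 1\<bar> * \<bar>B\<bar> < p"
    using alternating_sum_abs_less[of "\<lambda>n. r0 * f n + r1 * f (n + 1) + f (n + 2)" p,
        OF lower upper period(2)]
    by (simp only: abs_mult)
  moreover have "\<bar>r0 - r1 + 1\<bar> * real (2 * p) \<le> \<bar>r0 - r1 + 1\<bar> * \<bar>B\<bar>"
    using B by (intro mult_left_mono) auto
  ultimately have "(\<bar>r0 - r1 + 1\<bar> * 2) * p < 1 * real p" by simp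
  then have "\<bar>r0 - r1 + 1\<bar> * 2 < 1"
    using period(2) by (subst (asm) mult_less_cancel_right_pos) auto
  then show ?thesis by simp
qed

text \<open>Restarting the orbit at the first entry of the cycle removes the preperiod, so
  periodicity and recurrence hold at every index.\<close>

lemma srs_cycleE:
  assumes "srs_cycle (r0, r1) c"
  obtains f p where "p > 0" "\<And>n. f (n + p) = f n" "c = map f [0..<p]"
    "\<And>n. f (n + 2) = - \<lfloor>r0 * f n + r1 * f (n + 1)\<rfloor>"
proof -
  obtain a n0 p m where per: "periodic_from n0 p (srs_orbit (r0, r1) a)" and "m \<ge> n0"
    and c: "c = map (srs_orbit (r0, r1) a) [m..<m + p]"
    using assms unfolding srs_cycle_def by blast
  define f where "f n = srs_orbit (r0, r1) a (m + n)" for n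
  show thesis
  proof (rule that)
    show "p > 0" using per by (simp add: periodic_from_def)
    show "f (n + p) = f n" for n
      using per \<open>m \<ge> n0\<close> by (simp add: periodic_from_def f_def add.assoc[symmetric])
    show "c = map f [0..<p]"
      unfolding c by (rule nth_equalityI) (simp_all add: f_def)
    show "f (n + 2) = - \<lfloor>r0 * f n + r1 * f (n + 1)\<rfloor>" for n
      using srs_orbit_rec[of r0 r1 a "m + n"] by (simp add: f_def add.assoc)
  qed
qed

lemma alternating_cycle_bound:
  assumes "srs_cycle (r0, r1) c" "alternating_signs c"
  shows "\<bar>r0 - r1 + 1\<bar> < 1 / 2"
proof -
  obtain f p where "p > 0" and period: "\<And>n. f (n + p) = f n" and c: "c = map f [0..<p]"
    and rec: "\<And>n. f (n + 2) = - \<lfloor>r0 * f n + r1 * f (n + 1)\<rfloor>"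
    using srs_cycleE[OF assms(1)] by metis
  \<comment> \<open>\<open>alternating_signs\<close> speaks of one period with a cyclic successor;
    reducing indices modulo \<open>p\<close> extends its inequality to all \<open>n\<close>.\<close>
  have mod_period: "f n = f (n mod p)" for n
  proof -
    have "f (k + j * p) = f k" for k j
    proof (induction j)
      case (Suc j)
      then show ?case using period[of "k + j * p"] by (simp add: algebra_simps)
    qed simp
    from this[of "n mod p" "n div p"] show ?thesis by simp
  qed
  have "f n * f (Suc n) < 0" for n
  proof -
    have "f (n mod p) * f (Suc (n mod p) mod p) < 0"
      using assms(2) \<open>p > 0\<close> by (simp add: alternating_signs_def c)
    then show ?thesis using mod_period[of n] mod_period[of "Suc n"] by (simp add: mod_Suc_eq)
  qed
  moreover have "0 \<le> r0 * f n + r1 * f (n + 1) + f (n + 2)"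
    "r0 * f n + r1 * f (n + 1) + f (n + 2) < 1" for n
    using rec[of n] by linarith+
  ultimately show ?thesis
    using period \<open>p > 0\<close> by (intro periodic_alternating_bound)
qed

lemma cycle_uminus_imp:
  assumes "srs_cycle (r0, r1) [t, - t]" "t \<noteq> 0"
  shows "r0 - r1 + 1 = 0"
proof (rule srs_cycleE[OF assms(1)])
  fix f :: "nat \<Rightarrow> int" and p
  assume period: "\<And>n. f (n + p) = f n" and c: "[t, - t] = map f [0..<p]"
    and rec: "\<And>n. f (n + 2) = - \<lfloor>r0 * f n + r1 * f (n + 1)\<rfloor>"
  have "p = 2" using arg_cong[OF c, of length] by simp
  with c have vals: "f 0 = t" "f 1 = - t"
    by (simp_all add: upt_rec)
  moreover have "f 2 = t" "f 3 = - t"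
    using period[of 0] period[of 1] vals \<open>p = 2\<close> by (simp_all add: numeral_2_eq_2 numeral_3_eq_3)
  ultimately have "\<lfloor>r0 * t - r1 * t\<rfloor> = - t" "\<lfloor>- (r0 * t - r1 * t)\<rfloor> = t"
    using rec[of 0] rec[of 1] by (simp_all add: numeral_2_eq_2 numeral_3_eq_3)
  \<comment> \<open>The first floor gives x \<ge> -t, the second -x \<ge> t.\<close>
  then have "r0 * t - r1 * t = - t" by linarith
  then have "(r0 - r1 + 1) * t = 0" by (simp add: algebra_simps)
  with assms(2) show ?thesis by simp
qed

text \<open>On this line s * a + (s + 1) * (-a) = -a is an integer for integer a, so the floor
  changes nothing and signs just alternate. This orbit is the witness for both remaining
  claims.\<close>

lemma srs_orbit_alternating:
  fixes s :: real
  shows "srs_orbit (s, s + 1) (1, -1) n = (-1) ^ n"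
proof -
  have "(srs_map (s, s + 1) ^^ n) (1, -1) = ((-1) ^ n, (-1) ^ Suc n)"
  proof (induction n)
    case (Suc n)
    have "s * (-1) ^ n + (s + 1) * (-1) ^ Suc n = real_of_int ((-1) ^ Suc n)"
      by (simp add: algebra_simps)
    then have "\<lfloor>s * (-1) ^ n + (s + 1) * (-1) ^ Suc n\<rfloor> = (-1) ^ Suc n"
      by (simp only: floor_of_int)
    with Suc show ?case by (simp add: srs_map_def)
  qed simp
  then show ?thesis by (simp add: srs_orbit_def)
qed

lemma periodic_from_srs_orbit_alternating:
  "periodic_from 0 2 (srs_orbit (s, s + 1) (1, -1))"
  by (simp add: periodic_from_def srs_orbit_alternating)

theorem lemma3:
  fixes r0 r1 :: real
  shows "((\<exists>c. srs_cycle (r0, r1) c \<and> alternating_signs c) \<longrightarrow> \<bar>r0 - r1 + 1\<bar> < 1 / 2) \<and>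
    ((\<exists>t. t \<noteq> 0 \<and> srs_cycle (r0, r1) [t, - t]) \<longleftrightarrow> r0 - r1 + 1 = 0) \<and>
    {(s, s + 1) | s :: real. True} \<inter> D2_star = {}"
proof (intro conjI)
  show "(\<exists>c. srs_cycle (r0, r1) c \<and> alternating_signs c) \<longrightarrow> \<bar>r0 - r1 + 1\<bar> < 1 / 2"
    using alternating_cycle_bound by blast
  show "(\<exists>t. t \<noteq> 0 \<and> srs_cycle (r0, r1) [t, - t]) \<longleftrightarrow> r0 - r1 + 1 = 0"
  proof
    assume "r0 - r1 + 1 = 0"
    then have r1: "r1 = r0 + 1" by simp
    \<comment> \<open>The bound \<open>0 + 2\<close> matches \<open>n + p\<close> in
      \<open>srs_cycle_def\<close>.\<close>
    have "[1, - 1] = map (srs_orbit (r0, r1) (1, -1)) [0..<0 + 2]"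
      by (simp add: r1 srs_orbit_alternating upt_rec)
    moreover have "periodic_from 0 2 (srs_orbit (r0, r1) (1, -1))"
      unfolding r1 by (rule periodic_from_srs_orbit_alternating)
    ultimately have "srs_cycle (r0, r1) [1, - 1]"
      unfolding srs_cycle_def
      by (intro exI[of _ "(1, -1)"] exI[of _ 0] exI[of _ 2] conjI order_refl)
    then show "\<exists>t. t \<noteq> 0 \<and> srs_cycle (r0, r1) [t, - t]"
      by (intro exI[of _ 1]) simp
  qed (use cycle_uminus_imp in blast)
  \<comment> \<open>The alternating orbit is periodic but never 0.\<close>
  have "(s, s + 1) \<notin> D2_star" for s :: real
  proof
    assume "(s, s + 1) \<in> D2_star"
    moreover have "ultimately_periodic (srs_orbit (s, s + 1) (1, -1))"
      using periodic_from_srs_orbit_alternating unfolding ultimately_periodic_def by blast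
    ultimately obtain N where "\<forall>n\<ge>N. srs_orbit (s, s + 1) (1, -1) n = 0"
      unfolding D2_star_def by blast
    then show False by (auto simp: srs_orbit_alternating)
  qed
  then show "{(s, s + 1) | s :: real. True} \<inter> D2_star = {}" by blast
qed

end
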